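(* Let $D\in(0,\infty]$ and let $a,b$ be Borel measurable on $[0,D]$ with $a>0$ on $(0,D)$ and with $b/a$ and $e^{C}/a$ locally integrable on $[0,D]$, where $C(x)=\int_0^x \frac{b(u)}{a(u)}\,du$. Let $\lambda_0$ be the mixed (Neumann at $0$, Dirichlet at $D$) principal eigenvalue defined in the context. Then $\lambda_0>0$ if and only if $$\delta:=\sup_{x\in(0,D)}\mu(0,x)\,\nu(x,D)<\infty .$$ More precisely, $$(4\delta)^{-1}\le\lambda_0\le\delta^{-1}.$$ In particular, when $D=\infty$, we have $\lambda_0=0$ if $\nu(0,D)=\infty$, and $\lambda_0>0$ if $\int_0^\infty\mu(0,x)\,\nu(dx)<\infty$.
   Context: When $D=\infty$, $[0,D]$ is read as $[0,\infty)$ and $\mathcal C[0,D]$ as $\mathcal C[0,\infty)$. Convention $1/\infty=0$. $\mu(dx)=\frac{e^{C(x)}}{a(x)}dx$, $\nu(dx)=e^{-C(x)}dx$, $\mu(\alpha,\beta)=\int_\alpha^\beta d\mu$, $\nu(\alpha,\beta)=\int_\alpha^\beta d\nu$, $\mu(f)=\int_0^D f\,d\mu$, $D(f)=\int_0^D a\,f'^2\,d\mu$ (the functional $D(\cdot)$ is distinct from the endpoint $D$). With $\mathcal C_K[0,D]=\{f\in\mathcal C^1(0,D)\cap\mathcal C[0,D]: f\text{ has compact support}\}$, $$\lambda_0=\inf\{D(f):\mu(f^2)=1,\ f\in\mathcal C_K[0,D],\ f(D)=0\text{ if }D<\infty\}.$$ *)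

theory Defs
  imports "HOL-Analysis.Analysis"
begin

text \<open>
  The endpoint \<open>D\<close> is an extended real, and functions on the interval are total functions
  \<open>real \<Rightarrow> real\<close> of which only the values on the interval matter. The set below is \<open>[0,D]\<close> for
  finite \<open>D\<close> and \<open>[0,\<infinity>)\<close> for \<open>D = \<infinity>\<close>; the open interval \<open>(0,D)\<close> is \<open>einterval 0 D\<close>.
\<close>

definition closed_ival :: "ereal \<Rightarrow> real set" where
  "closed_ival D = {x. 0 \<le> x \<and> ereal x \<le> D}"

definition locally_integrable_on :: "real set \<Rightarrow> (real \<Rightarrow> real) \<Rightarrow> bool" where
  "locally_integrable_on S f \<longleftrightarrow> (\<forall>K. compact K \<and> K \<subseteq> S \<longrightarrow> set_integrable lborel K f)"

definition Cfun :: "(real \<Rightarrow> real) \<Rightarrow> (real \<Rightarrow> real) \<Rightarrow> real \<Rightarrow> real" where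
  "Cfun a b x = (LBINT u=0..ereal x. b u / a u)"

text \<open>
  The measures carry the indicator of the open interval, since nothing is assumed about the sign
  of \<open>a\<close> at the endpoints, which are Lebesgue null, or about \<open>a\<close> and \<open>b\<close> outside \<open>[0,D]\<close>.
\<close>

definition mu :: "(real \<Rightarrow> real) \<Rightarrow> (real \<Rightarrow> real) \<Rightarrow> ereal \<Rightarrow> real measure" where
  "mu a b D = density lborel
     (\<lambda>x. ennreal (exp (Cfun a b x) / a x) * indicator (einterval 0 D) x)"

definition nu :: "(real \<Rightarrow> real) \<Rightarrow> (real \<Rightarrow> real) \<Rightarrow> ereal \<Rightarrow> real measure" where
  "nu a b D = density lborel
     (\<lambda>x. ennreal (exp (- Cfun a b x)) * indicator (einterval 0 D) x)"

text \<open>The form takes values in \<open>[0,\<infinity>]\<close>: the derivative may fail to be square integrable.\<close>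

definition dirichlet_form ::
    "(real \<Rightarrow> real) \<Rightarrow> (real \<Rightarrow> real) \<Rightarrow> ereal \<Rightarrow> (real \<Rightarrow> real) \<Rightarrow> ennreal" where
  "dirichlet_form a b D f = (\<integral>\<^sup>+ x. ennreal (a x * (deriv f x)\<^sup>2) \<partial>mu a b D)"

text \<open>
  The closure is taken in \<open>\<real>\<close>; it agrees with the closure in \<open>closed_ival D\<close>, which is closed
  in \<open>\<real>\<close>. The support may contain the endpoint \<open>0\<close>.
\<close>

definition C_K :: "ereal \<Rightarrow> (real \<Rightarrow> real) set" where
  "C_K D = {f. f C1_differentiable_on einterval 0 D \<and> continuous_on (closed_ival D) f \<and>
               compact (closure {x \<in> closed_ival D. f x \<noteq> 0})}"

definition lambda0 :: "(real \<Rightarrow> real) \<Rightarrow> (real \<Rightarrow> real) \<Rightarrow> ereal \<Rightarrow> ennreal" where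
  "lambda0 a b D = Inf {dirichlet_form a b D f | f.
     (\<integral>\<^sup>+ x. ennreal ((f x)\<^sup>2) \<partial>mu a b D) = 1 \<and> f \<in> C_K D \<and>
     (D < \<infinity> \<longrightarrow> f (real_of_ereal D) = 0)}"

definition delta :: "(real \<Rightarrow> real) \<Rightarrow> (real \<Rightarrow> real) \<Rightarrow> ereal \<Rightarrow> ennreal" where
  "delta a b D = (SUP x \<in> einterval 0 D.
     emeasure (mu a b D) (einterval 0 (ereal x)) * emeasure (nu a b D) (einterval (ereal x) D))"

end

theory Submission
  imports Defs
begin

text \<open>
  Write \<open>P = e\<^sup>C/a\<close> and \<open>q = e\<^sup>-\<^sup>C\<close> for the densities of \<open>\<mu>\<close> and \<open>\<nu>\<close>, and \<open>M x = \<mu>(0,x)\<close>,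
  \<open>N x = \<nu>(x,D)\<close>. Since \<open>a P = 1/q\<close>, the form is \<open>\<integral> f'\<^sup>2/q\<close>, and \<open>\<lambda>\<^sub>0\<close> is the reciprocal of the best
  constant in the weighted Hardy inequality \<open>\<integral> f\<^sup>2 P \<le> A \<integral> f'\<^sup>2/q\<close> for functions vanishing at \<open>D\<close>.
  The theorem is Muckenhoupt's two-sided estimate \<open>\<delta> \<le> A \<le> 4\<delta>\<close>.

  The bound \<open>A \<le> 4\<delta>\<close> (\<open>muckenhoupt_inequality\<close>). From \<open>\<bar>f x\<bar> \<le> \<integral>\<^sub>x\<^sup>D \<bar>f'\<bar>\<close>, the Cauchy-Schwarz
  inequality with the weight \<open>\<surd>N\<close> gives \<open>f(x)\<^sup>2 \<le> 2 \<surd>(N x) \<integral>\<^sub>x\<^sup>D f'\<^sup>2 \<surd>N / q\<close>, because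
  \<open>\<surd>N\<close> is an antiderivative of \<open>-q/(2\<surd>N)\<close>. Integrating against \<open>P\<close> and exchanging the integrals
  reduces the claim to \<open>\<integral>\<^sub>0\<^sup>y \<surd>N d\<mu> \<le> 2\<delta>/\<surd>(N y)\<close>. For this, write
  \<open>\<surd>(N x) = \<surd>(N y) + \<integral>\<^sub>x\<^sup>y q/(2\<surd>N)\<close>, exchange once more, and replace \<open>M\<close> by \<open>\<delta>/N\<close>;
  what remains is the integral of the derivative of \<open>1/\<surd>N\<close>. In this form only the smooth function
  \<open>N\<close> is ever differentiated, and never \<open>M\<close>, whose density is merely measurable.

  The bound \<open>\<delta> \<le> A\<close> (\<open>lambda0_mult_cutoff_le\<close>). The natural trial function is \<open>y \<mapsto> N(max x y)\<close>,
  which equals \<open>N x\<close> on \<open>(0,x)\<close> and has energy \<open>N x\<close>, so that its quotient is at most \<open>1/(M x N x)\<close>.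
  It has a kink at \<open>x\<close> and, if \<open>D = \<infinity>\<close>, unbounded support; it is therefore approximated by
  \<open>y \<mapsto> \<integral>\<^sub>y\<^sup>D \<phi> q\<close> with continuous cutoffs \<open>\<phi>\<close> increasing to the indicator of \<open>(x,D)\<close>
  (\<open>lambda0_mult_M_N_le\<close>). The same argument gives \<open>\<lambda>\<^sub>0 = 0\<close> when \<open>\<delta> = \<infinity>\<close>.

  The two statements for \<open>D = \<infinity>\<close> follow: \<open>\<nu>(0,\<infinity>) = \<infinity>\<close> makes \<open>N 1\<close> infinite while \<open>M 1 > 0\<close>, and
  \<open>M x N x \<le> \<integral>\<^sub>x\<^sup>D M d\<nu>\<close> because \<open>M\<close> is increasing.
\<close>

section \<open>Derivatives and integrals on open intervals\<close>

lemma ennreal_inverse_mult_self: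
  fixes x :: ennreal
  assumes "x \<noteq> 0" "x \<noteq> \<infinity>"
  shows "inverse x * x = 1"
  using ennreal_divide_self[of x] assms by (simp add: divide_ennreal_def mult.commute less_top)

lemma borel_measurable_ennreal_indicator:
  fixes f :: "real \<Rightarrow> real"
  assumes "continuous_on A f" and "A \<in> sets borel"
  shows "(\<lambda>x. ennreal (f x) * indicator A x) \<in> borel_measurable borel"
proof -
  have "(\<lambda>x. indicator A x *\<^sub>R f x) \<in> borel_measurable borel"
    using assms by (rule borel_measurable_continuous_on_indicator[rotated])
  then have "(\<lambda>x. ennreal (indicator A x *\<^sub>R f x)) \<in> borel_measurable borel"
    by measurable
  moreover have "ennreal (indicator A x *\<^sub>R f x) = ennreal (f x) * indicator A x" for x
    by (simp split: split_indicator)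
  ultimately show ?thesis by simp
qed

lemma nn_integral_abs_deriv_ge:
  fixes F g :: "real \<Rightarrow> real"
  assumes "x \<le> y"
    and F: "\<And>t. x \<le> t \<Longrightarrow> t \<le> y \<Longrightarrow> (F has_real_derivative g t) (at t)"
    and g: "continuous_on {x..y} g"
  shows "ennreal \<bar>F y - F x\<bar> \<le> (\<integral>\<^sup>+t\<in>{x..y}. ennreal \<bar>g t\<bar> \<partial>lborel)"
proof -
  have *: "has_bochner_integral lborel (\<lambda>t. indicator {x..y} t *\<^sub>R g t) (F y - F x)"
    using F by (intro has_bochner_integral_FTC_Icc assms)
      (auto intro: has_field_derivative_at_within simp flip: has_real_derivative_iff_has_vector_derivative)
  have "ennreal (norm (F y - F x)) \<le> (\<integral>\<^sup>+t. norm (indicator {x..y} t *\<^sub>R g t) \<partial>lborel)"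
    using has_bochner_integral_norm_bound[OF *] .
  also have "\<dots> = (\<integral>\<^sup>+t\<in>{x..y}. ennreal \<bar>g t\<bar> \<partial>lborel)"
    by (intro nn_integral_cong) (simp split: split_indicator)
  finally show ?thesis by simp
qed

lemma nn_integral_FTC_Ioo:
  fixes F g :: "real \<Rightarrow> real"
  assumes "x \<le> y"
    and F: "\<And>t. x \<le> t \<Longrightarrow> t \<le> y \<Longrightarrow> (F has_real_derivative g t) (at t)"
    and g: "continuous_on {x..y} g"
    and nonneg: "\<And>t. x \<le> t \<Longrightarrow> t \<le> y \<Longrightarrow> 0 \<le> g t"
  shows "(\<integral>\<^sup>+t\<in>{x<..<y}. ennreal (g t) \<partial>lborel) = ennreal (F y - F x)"
proof -
  have *: "has_bochner_integral lborel (\<lambda>t. indicator {x..y} t *\<^sub>R g t) (F y - F x)"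
    using F by (intro has_bochner_integral_FTC_Icc assms)
      (auto intro: has_field_derivative_at_within simp flip: has_real_derivative_iff_has_vector_derivative)
  have "(\<integral>\<^sup>+t\<in>{x<..<y}. ennreal (g t) \<partial>lborel)
      = (\<integral>\<^sup>+t. ennreal (indicator {x..y} t *\<^sub>R g t) \<partial>lborel)"
  proof (rule nn_integral_cong_AE)
    show "AE t in lborel. ennreal (g t) * indicator {x<..<y} t = ennreal (indicator {x..y} t *\<^sub>R g t)"
      using AE_lborel_singleton[of x] AE_lborel_singleton[of y]
      by eventually_elim (auto split: split_indicator)
  qed
  also have "\<dots> = ennreal (integral\<^sup>L lborel (\<lambda>t. indicator {x..y} t *\<^sub>R g t))"
    using * nonneg by (intro nn_integral_eq_integral)
      (auto simp: has_bochner_integral_iff split: split_indicator)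
  finally show ?thesis
    using * by (simp add: has_bochner_integral_iff)
qed

text \<open>
  The endpoints may be infinite, and \<open>F\<close> need not have limits there: a bound on its increments is all
  that is required, since the interval is exhausted by compact ones.
\<close>

lemma nn_integral_einterval_le:
  fixes \<alpha> \<beta> :: ereal and F g :: "real \<Rightarrow> real"
  assumes F: "\<And>t. t \<in> einterval \<alpha> \<beta> \<Longrightarrow> (F has_real_derivative g t) (at t)"
    and g: "continuous_on (einterval \<alpha> \<beta>) g"
    and nonneg: "\<And>t. t \<in> einterval \<alpha> \<beta> \<Longrightarrow> 0 \<le> g t"
    and B: "\<And>u v. u \<in> einterval \<alpha> \<beta> \<Longrightarrow> v \<in> einterval \<alpha> \<beta> \<Longrightarrow> u \<le> v \<Longrightarrow> F v - F u \<le> B"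
  shows "(\<integral>\<^sup>+t\<in>einterval \<alpha> \<beta>. ennreal (g t) \<partial>lborel) \<le> ennreal B"
proof (cases "\<alpha> < \<beta>")
  case False
  then have "einterval \<alpha> \<beta> = {}" by (auto simp: einterval_iff)
  then show ?thesis by simp
next
  case True
  then obtain u l :: "nat \<Rightarrow> real" where ul: "einterval \<alpha> \<beta> = (\<Union>i. {l i .. u i})"
    "incseq u" "decseq l" "\<And>i. l i < u i" "\<And>i. \<alpha> < l i" "\<And>i. u i < \<beta>"
    by (rule einterval_Icc_approximation) blast
  have sub: "{l i .. u i} \<subseteq> einterval \<alpha> \<beta>" for i
    using ul(1) by auto
  have nest: "i \<le> j \<Longrightarrow> {l i .. u i} \<subseteq> {l j .. u j}" for i j
    using ul(2,3) by (auto simp: incseq_def decseq_def intro: order_trans)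
  have eq: "ennreal (g t) * indicator (einterval \<alpha> \<beta>) t
     = (SUP i. ennreal (g t) * indicator {l i .. u i} t)" for t
  proof (cases "t \<in> einterval \<alpha> \<beta>")
    case False
    then have "indicator {l i .. u i} t = (0::ennreal)" for i using sub[of i] by (auto simp: indicator_def)
    then show ?thesis using False by simp
  next
    case True
    then obtain i where "t \<in> {l i .. u i}" using ul(1) by auto
    then have "ennreal (g t) \<le> (SUP i. ennreal (g t) * indicator {l i .. u i} t)"
      by (intro SUP_upper2[of i]) auto
    moreover have "(SUP i. ennreal (g t) * indicator {l i .. u i} t) \<le> ennreal (g t)"
      by (intro SUP_least) (auto split: split_indicator)
    ultimately show ?thesis using True by simp
  qed
  have "(\<integral>\<^sup>+t\<in>einterval \<alpha> \<beta>. ennreal (g t) \<partial>lborel)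
      = (\<integral>\<^sup>+t. (SUP i. ennreal (g t) * indicator {l i .. u i} t) \<partial>lborel)"
    by (simp only: eq)
  also have "\<dots> = (SUP i. \<integral>\<^sup>+t\<in>{l i .. u i}. ennreal (g t) \<partial>lborel)"
  proof (rule nn_integral_monotone_convergence_SUP)
    show "incseq (\<lambda>i t. ennreal (g t) * indicator {l i .. u i} t)"
      by (auto simp: incseq_def le_fun_def split: split_indicator dest!: subsetD[OF nest])
    show "(\<lambda>t. ennreal (g t) * indicator {l i .. u i} t) \<in> borel_measurable lborel" for i
      using borel_measurable_ennreal_indicator[OF continuous_on_subset[OF g sub[of i]]] by simp
  qed
  also have "\<dots> \<le> ennreal B"
  proof (rule SUP_least)
    fix i
    have "(\<integral>\<^sup>+t\<in>{l i .. u i}. ennreal (g t) \<partial>lborel) = (\<integral>\<^sup>+t\<in>{l i <..< u i}. ennreal (g t) \<partial>lborel)"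
      using AE_lborel_singleton[of "l i"] AE_lborel_singleton[of "u i"]
      by (intro nn_integral_cong_AE, eventually_elim) (auto split: split_indicator)
    also have "\<dots> = ennreal (F (u i) - F (l i))"
      using ul(4)[of i] sub[of i] by (intro nn_integral_FTC_Ioo F continuous_on_subset[OF g] nonneg) auto
    also have "\<dots> \<le> ennreal B"
      using ul(4)[of i] sub[of i] by (intro ennreal_leI B) auto
    finally show "(\<integral>\<^sup>+t\<in>{l i .. u i}. ennreal (g t) \<partial>lborel) \<le> ennreal B" .
  qed
  finally show ?thesis .
qed

section \<open>Muckenhoupt's weighted Hardy inequality\<close>

text \<open>
  The function \<open>N\<close> plays the part of \<open>\<integral>\<^sub>t\<^sup>\<beta> q\<close>, and \<open>g\<close> that of \<open>f'\<close>. Both Cauchy-Schwarz weights are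
  powers of \<open>N\<close>; the exponent \<open>1/2\<close> is the one for which the losses \<open>2\<close> and \<open>2\<delta>\<close> of the two halves of
  the argument multiply to the optimal \<open>4\<delta>\<close>.
\<close>

lemma muckenhoupt_inequality:
  fixes \<alpha> \<beta> :: ereal and P :: "real \<Rightarrow> ennreal" and q N f g :: "real \<Rightarrow> real" and \<delta> :: real
  defines "I \<equiv> einterval \<alpha> \<beta>"
  assumes P[measurable]: "P \<in> borel_measurable borel"
    and q: "continuous_on I q" "\<And>t. t \<in> I \<Longrightarrow> 0 < q t"
    and N: "\<And>t. t \<in> I \<Longrightarrow> (N has_real_derivative - q t) (at t)" "\<And>t. t \<in> I \<Longrightarrow> 0 < N t"
    and M: "\<And>t. t \<in> I \<Longrightarrow> (\<integral>\<^sup>+x\<in>einterval \<alpha> t. P x \<partial>lborel) \<le> ennreal (\<delta> / N t)"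
    and "0 \<le> \<delta>"
    and g: "continuous_on I g"
    and f: "\<And>x. x \<in> I \<Longrightarrow> ennreal \<bar>f x\<bar> \<le> (\<integral>\<^sup>+t\<in>einterval x \<beta>. ennreal \<bar>g t\<bar> \<partial>lborel)"
  shows "(\<integral>\<^sup>+x\<in>I. P x * ennreal ((f x)\<^sup>2) \<partial>lborel)
    \<le> ennreal (4 * \<delta>) * (\<integral>\<^sup>+t\<in>I. ennreal ((g t)\<^sup>2 / q t) \<partial>lborel)"
proof -
  have I[measurable]: "I \<in> sets borel" by (simp add: I_def)
  have Icl: "{x..y} \<subseteq> I" if "x \<in> I" "y \<in> I" for x y
    using that by (auto simp: I_def einterval_iff) (meson ereal_less_eq(3) less_le_trans le_less_trans)+
  have tail: "einterval x \<beta> = I \<inter> {x<..}" if "x \<in> I" for x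
  proof -
    have "\<alpha> < ereal t" if "x < t" for t
      using \<open>x \<in> I\<close> that by (auto simp: I_def einterval_iff intro: less_trans[of _ "ereal x"])
    then show ?thesis by (auto simp: I_def einterval_iff)
  qed
  have head: "einterval \<alpha> x = I \<inter> {..<x}" if "x \<in> I" for x
  proof -
    have "ereal t < \<beta>" if "t < x" for t
      using \<open>x \<in> I\<close> that by (auto simp: I_def einterval_iff intro: less_trans[of _ "ereal x"])
    then show ?thesis by (auto simp: I_def einterval_iff)
  qed
  have cN: "continuous_on I N"
    using N(1) by (meson DERIV_isCont continuous_at_imp_continuous_on)
  have csN: "continuous_on I (\<lambda>t. sqrt (N t))"
    by (intro continuous_intros cN)
  have sN: "((\<lambda>t. sqrt (N t)) has_real_derivative - (q t / (2 * sqrt (N t)))) (at t)" if "t \<in> I" for t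
    using N(1)[OF that] N(2)[OF that]
    by (auto intro!: derivative_eq_intros simp: field_simps)
  have isN: "((\<lambda>t. 1 / sqrt (N t)) has_real_derivative q t / (2 * N t * sqrt (N t))) (at t)" if "t \<in> I" for t
    using N(2)[OF that]
    by (auto intro!: derivative_eq_intros N(1)[OF that] simp: field_simps)
  have antimono: "N y \<le> N x" if "x \<le> y" "x \<in> I" "y \<in> I" for x y
  proof (rule DERIV_nonpos_imp_nonincreasing[OF \<open>x \<le> y\<close>])
    fix t assume "x \<le> t" "t \<le> y"
    then have "t \<in> I" using Icl[OF that(2,3)] by auto
    then show "\<exists>z. (N has_real_derivative z) (at t) \<and> z \<le> 0"
      using N(1) q(2) by (intro exI[of _ "- q t"]) (auto intro: less_imp_le)
  qed
  note nz = less_imp_neq[OF N(2), symmetric] less_imp_neq[OF q(2), symmetric]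
  have cU: "continuous_on I (\<lambda>t. q t / (2 * sqrt (N t)))"
    by (intro continuous_intros q(1) cN) (simp add: nz)
  define W where "W t = ennreal (sqrt (N t)) * indicator I t" for t
  define U where "U t = ennreal (q t / (2 * sqrt (N t))) * indicator I t" for t
  define A where "A t = ennreal ((g t)\<^sup>2 / q t * sqrt (N t)) * indicator I t" for t
  have [measurable]: "W \<in> borel_measurable borel" "U \<in> borel_measurable borel" "A \<in> borel_measurable borel"
    unfolding W_def U_def A_def
    by (intro borel_measurable_ennreal_indicator I continuous_intros q(1) g csN; simp add: nz)+

  \<comment> \<open>\<open>U\<close> is the derivative of \<open>-\<surd>N\<close>, so its integral over the tail is at most \<open>\<surd>(N x)\<close>.\<close>
  have upper: "(\<integral>\<^sup>+t. U t * indicator {x<..} t \<partial>lborel) \<le> ennreal (sqrt (N x))" if x: "x \<in> I" for x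
  proof -
    have sub: "einterval x \<beta> \<subseteq> I"
      using tail[OF x] by auto
    have "(\<integral>\<^sup>+t\<in>einterval x \<beta>. ennreal (q t / (2 * sqrt (N t))) \<partial>lborel) \<le> ennreal (sqrt (N x))"
    proof (rule nn_integral_einterval_le)
      show "((\<lambda>t. - sqrt (N t)) has_real_derivative q t / (2 * sqrt (N t))) (at t)"
        if "t \<in> einterval x \<beta>" for t
        using DERIV_minus[OF sN[of t]] that sub by auto
      show "continuous_on (einterval x \<beta>) (\<lambda>t. q t / (2 * sqrt (N t)))"
        using cU sub by (rule continuous_on_subset)
      show "0 \<le> q t / (2 * sqrt (N t))" if "t \<in> einterval x \<beta>" for t
        using q(2)[of t] N(2)[of t] that sub by auto
      show "- sqrt (N v) - (- sqrt (N u)) \<le> sqrt (N x)"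
        if "u \<in> einterval x \<beta>" "v \<in> einterval x \<beta>" for u v
      proof -
        have "x \<le> u" "u \<in> I" "v \<in> I" using that sub by (auto simp: einterval_iff)
        have "N u \<le> N x" using antimono[of x u] \<open>x \<le> u\<close> x \<open>u \<in> I\<close> by simp
        then show ?thesis using N(2)[OF \<open>v \<in> I\<close>] by (smt (verit) real_sqrt_le_iff real_sqrt_ge_zero)
      qed
    qed
    also have "(\<integral>\<^sup>+t\<in>einterval x \<beta>. ennreal (q t / (2 * sqrt (N t))) \<partial>lborel)
        = (\<integral>\<^sup>+t. U t * indicator {x<..} t \<partial>lborel)"
      using x by (intro nn_integral_cong) (auto simp: U_def tail split: split_indicator)
    finally show ?thesis .
  qed

  have pointwise: "ennreal ((f x)\<^sup>2) \<le> 2 * W x * (\<integral>\<^sup>+t. A t * indicator {x<..} t \<partial>lborel)" if x: "x \<in> I" for x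
  proof -
    \<comment> \<open>The product \<open>u v\<close> is \<open>\<bar>g\<bar>\<close>, while \<open>u\<^sup>2 = A\<close> and \<open>v\<^sup>2 = 2 U\<close> on the tail.\<close>
    define u where "u t = ennreal (sqrt ((g t)\<^sup>2 / q t * sqrt (N t))) * indicator I t * indicator {x<..} t" for t
    define v where "v t = ennreal (sqrt (q t / sqrt (N t))) * indicator I t * indicator {x<..} t" for t
    have [measurable]: "(\<lambda>t. ennreal (sqrt ((g t)\<^sup>2 / q t * sqrt (N t))) * indicator I t) \<in> borel_measurable borel"
      by (intro borel_measurable_ennreal_indicator I continuous_intros q(1) g csN) (simp add: nz)
    have [measurable]: "(\<lambda>t. ennreal (sqrt (q t / sqrt (N t))) * indicator I t) \<in> borel_measurable borel"
      by (intro borel_measurable_ennreal_indicator I continuous_intros q(1) g csN) (simp add: nz)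
    have [measurable]: "u \<in> borel_measurable borel" "v \<in> borel_measurable borel"
      unfolding u_def v_def by measurable
    have uv: "u t * v t = ennreal \<bar>g t\<bar> * indicator (einterval x \<beta>) t" for t
    proof (cases "t \<in> I \<and> x < t")
      case True
      then have "sqrt ((g t)\<^sup>2 / q t * sqrt (N t)) * sqrt (q t / sqrt (N t)) = \<bar>g t\<bar>"
        using nz[of t] by (simp flip: real_sqrt_mult)
      then show ?thesis using True q(2)[of t] N(2)[of t]
        by (auto simp: u_def v_def tail x simp flip: ennreal_mult)
    next
      case False
      then show ?thesis using x
        by (auto simp: u_def v_def tail split: split_indicator)
    qed
    have u2: "(u t)\<^sup>2 = A t * indicator {x<..} t" for t
      using q(2)[of t] N(2)[of t]
      by (auto simp: u_def A_def ennreal_power split: split_indicator)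
    have v2: "(v t)\<^sup>2 = 2 * (U t * indicator {x<..} t)" for t
      using q(2)[of t] N(2)[of t]
      by (auto simp: v_def U_def ennreal_power ennreal_mult[symmetric]
           simp flip: ennreal_numeral split: split_indicator)
    have "ennreal ((f x)\<^sup>2) = (ennreal \<bar>f x\<bar>)\<^sup>2"
      by (simp add: ennreal_power)
    also have "\<dots> \<le> (\<integral>\<^sup>+t. u t * v t \<partial>lborel)\<^sup>2"
      unfolding uv by (intro power_mono f x) auto
    also have "\<dots> \<le> (\<integral>\<^sup>+t. (u t)\<^sup>2 \<partial>lborel) * (\<integral>\<^sup>+t. (v t)\<^sup>2 \<partial>lborel)"
      by (intro Cauchy_Schwarz_nn_integral) auto
    also have "\<dots> = (\<integral>\<^sup>+t. A t * indicator {x<..} t \<partial>lborel) * (2 * (\<integral>\<^sup>+t. U t * indicator {x<..} t \<partial>lborel))"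
      unfolding u2 v2 by (subst nn_integral_cmult) auto
    also have "\<dots> \<le> (\<integral>\<^sup>+t. A t * indicator {x<..} t \<partial>lborel) * (2 * ennreal (sqrt (N x)))"
      by (intro mult_left_mono upper x) auto
    finally show ?thesis using x by (simp add: W_def ac_simps)
  qed

  \<comment> \<open>One \<open>\<delta>/\<surd>(N y)\<close> comes from the constant part \<open>\<surd>(N y)\<close> of \<open>\<surd>N\<close>, one from its increment.\<close>
  have weight: "(\<integral>\<^sup>+x. P x * W x * indicator {..<y} x \<partial>lborel) \<le> ennreal (2 * \<delta> / sqrt (N y))"
    if y: "y \<in> I" for y
  proof -
    define m where "m t = (\<integral>\<^sup>+x. P x * indicator I x * indicator {..<t} x \<partial>lborel)" for t
    have m: "m t \<le> ennreal (\<delta> / N t)" if t: "t \<in> I" for t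
    proof -
      have "m t = (\<integral>\<^sup>+x\<in>einterval \<alpha> t. P x \<partial>lborel)"
        unfolding m_def using t
        by (intro nn_integral_cong) (auto simp: head split: split_indicator)
      then show ?thesis using M[OF t] by simp
    qed
    \<comment> \<open>The fundamental theorem of calculus turns \<open>\<surd>N\<close> into an integral, so that Fubini applies.\<close>
    have W_split: "P x * W x * indicator {..<y} x = P x * indicator I x * indicator {..<y} x * ennreal (sqrt (N y))
        + (\<integral>\<^sup>+t. P x * indicator I x * U t * (if x < t then 1 else 0) * indicator {..<y} t \<partial>lborel)" for x
    proof (cases "x \<in> I \<and> x < y")
      case True
      then have sub: "{x..y} \<subseteq> I" using Icl y by auto
      have "(\<integral>\<^sup>+t. U t * (if x < t then 1 else 0) * indicator {..<y} t \<partial>lborel)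
          = (\<integral>\<^sup>+t\<in>{x<..<y}. ennreal (q t / (2 * sqrt (N t))) \<partial>lborel)"
        using sub by (intro nn_integral_cong) (auto simp: U_def subset_iff split: split_indicator)
      also have "\<dots> = ennreal (- sqrt (N y) - - sqrt (N x))"
      proof (rule nn_integral_FTC_Ioo)
        show "x \<le> y" using True by simp
        show "((\<lambda>t. - sqrt (N t)) has_real_derivative q t / (2 * sqrt (N t))) (at t)"
          if "x \<le> t" "t \<le> y" for t
          using DERIV_minus[OF sN[of t]] that sub by auto
        show "continuous_on {x..y} (\<lambda>t. q t / (2 * sqrt (N t)))"
          using cU sub by (rule continuous_on_subset)
        show "0 \<le> q t / (2 * sqrt (N t))" if "x \<le> t" "t \<le> y" for t
          using q(2)[of t] N(2)[of t] that sub by (auto simp: subset_iff)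
      qed
      finally have eq: "(\<integral>\<^sup>+t. U t * (if x < t then 1 else 0) * indicator {..<y} t \<partial>lborel)
          = ennreal (sqrt (N x) - sqrt (N y))"
        by simp
      have "ennreal (sqrt (N y)) + (\<integral>\<^sup>+t. U t * (if x < t then 1 else 0) * indicator {..<y} t \<partial>lborel)
          = ennreal (sqrt (N x))"
      proof -
        have "sqrt (N y) \<le> sqrt (N x)"
          using antimono[of x y] True y by simp
        moreover have "0 \<le> sqrt (N y)" using N(2)[OF y] by simp
        ultimately show ?thesis unfolding eq by (simp flip: ennreal_plus)
      qed
      moreover have "(\<integral>\<^sup>+t. P x * indicator I x * U t * (if x < t then 1 else 0) * indicator {..<y} t \<partial>lborel)
          = P x * (\<integral>\<^sup>+t. U t * (if x < t then 1 else 0) * indicator {..<y} t \<partial>lborel)"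
        using True by (subst nn_integral_cmult[symmetric]) (auto simp: mult.assoc)
      ultimately show ?thesis using True by (simp add: W_def flip: distrib_left)
    next
      case False
      have "P x * indicator I x * U t * (if x < t then 1 else 0) * indicator {..<y} t = 0" for t
        using False by (auto split: split_indicator)
      moreover have "P x * W x * indicator {..<y} x = 0" "P x * indicator I x * indicator {..<y} x = 0"
        using False by (auto simp: W_def split: split_indicator)
      ultimately show ?thesis by (simp only:) simp
    qed
    have "(\<integral>\<^sup>+x. P x * W x * indicator {..<y} x \<partial>lborel)
      = m y * ennreal (sqrt (N y))
        + (\<integral>\<^sup>+x. \<integral>\<^sup>+t. P x * indicator I x * U t * (if x < t then 1 else 0) * indicator {..<y} t \<partial>lborel \<partial>lborel)"
      unfolding W_split m_def by (subst nn_integral_add) (auto simp: nn_integral_multc)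
    also have "(\<integral>\<^sup>+x. \<integral>\<^sup>+t. P x * indicator I x * U t * (if x < t then 1 else 0) * indicator {..<y} t \<partial>lborel \<partial>lborel)
      = (\<integral>\<^sup>+t. \<integral>\<^sup>+x. P x * indicator I x * U t * (if x < t then 1 else 0) * indicator {..<y} t \<partial>lborel \<partial>lborel)"
      by (rule lborel_pair.Fubini') measurable
    also have "\<dots> = (\<integral>\<^sup>+t. U t * indicator {..<y} t * m t \<partial>lborel)"
      unfolding m_def
      by (subst nn_integral_cmult[symmetric])
        (auto intro!: nn_integral_cong simp: ac_simps split: split_indicator)
    also have "\<dots> \<le> (\<integral>\<^sup>+t\<in>einterval \<alpha> y. ennreal (\<delta> * (q t / (2 * N t * sqrt (N t)))) \<partial>lborel)"
    proof (rule nn_integral_mono)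
      fix t
      show "U t * indicator {..<y} t * m t
        \<le> ennreal (\<delta> * (q t / (2 * N t * sqrt (N t)))) * indicator (einterval \<alpha> y) t"
      proof (cases "t \<in> I \<and> t < y")
        case True
        then have "U t * m t \<le> ennreal (q t / (2 * sqrt (N t))) * ennreal (\<delta> / N t)"
          using m by (auto simp: U_def intro!: mult_left_mono)
        also have "\<dots> = ennreal (\<delta> * (q t / (2 * N t * sqrt (N t))))"
          using True q(2)[of t] N(2)[of t] \<open>0 \<le> \<delta>\<close> by (simp flip: ennreal_mult add: field_simps)
        finally show ?thesis using True by (simp add: head y)
      next
        case False
        then show ?thesis by (auto simp: U_def split: split_indicator)
      qed
    qed
    also have "\<dots> \<le> ennreal (\<delta> * (1 / sqrt (N y)))"
    proof -
      have sub: "einterval \<alpha> y \<subseteq> I"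
        using head[OF y] by auto
      show ?thesis
      proof (rule nn_integral_einterval_le)
        show "((\<lambda>t. \<delta> * (1 / sqrt (N t))) has_real_derivative \<delta> * (q t / (2 * N t * sqrt (N t)))) (at t)"
          if "t \<in> einterval \<alpha> y" for t
          using that sub by (intro DERIV_cmult isN) auto
        show "continuous_on (einterval \<alpha> y) (\<lambda>t. \<delta> * (q t / (2 * N t * sqrt (N t))))"
          using sub by (intro continuous_intros continuous_on_subset[OF csN] continuous_on_subset[OF q(1)]
             continuous_on_subset[OF cN]) (auto dest: nz)
        show "0 \<le> \<delta> * (q t / (2 * N t * sqrt (N t)))" if "t \<in> einterval \<alpha> y" for t
          using q(2)[of t] N(2)[of t] that sub \<open>0 \<le> \<delta>\<close> by auto
        show "\<delta> * (1 / sqrt (N v)) - \<delta> * (1 / sqrt (N u)) \<le> \<delta> * (1 / sqrt (N y))"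
          if "u \<in> einterval \<alpha> y" "v \<in> einterval \<alpha> y" for u v
        proof -
          have "v \<le> y" "v \<in> I" "u \<in> I" using that sub by (auto simp: einterval_iff)
          have "1 / sqrt (N v) \<le> 1 / sqrt (N y)"
            using antimono[of v y] \<open>v \<le> y\<close> \<open>v \<in> I\<close> y N(2)[OF y] by (intro divide_left_mono) auto
          then have "\<delta> * (1 / sqrt (N v)) \<le> \<delta> * (1 / sqrt (N y))"
            using \<open>0 \<le> \<delta>\<close> by (rule mult_left_mono)
          moreover have "0 \<le> \<delta> * (1 / sqrt (N u))"
            using \<open>0 \<le> \<delta>\<close> N(2)[OF \<open>u \<in> I\<close>] by simp
          ultimately show ?thesis by linarith
        qed
      qed
    qed
    also have "m y * ennreal (sqrt (N y)) \<le> ennreal (\<delta> * (1 / sqrt (N y)))"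
    proof -
      have "m y * ennreal (sqrt (N y)) \<le> ennreal (\<delta> / N y) * ennreal (sqrt (N y))"
        by (intro mult_right_mono m y) auto
      also have "\<dots> = ennreal (\<delta> * (1 / sqrt (N y)))"
        using N(2)[OF y] \<open>0 \<le> \<delta>\<close> by (simp flip: ennreal_mult add: field_simps)
      finally show ?thesis .
    qed
    finally show ?thesis
      using N(2)[OF y] \<open>0 \<le> \<delta>\<close> by (simp add: add_mono flip: ennreal_plus)
  qed

  have "(\<integral>\<^sup>+x\<in>I. P x * ennreal ((f x)\<^sup>2) \<partial>lborel)
    \<le> (\<integral>\<^sup>+x. \<integral>\<^sup>+t. 2 * P x * W x * A t * (if x < t then 1 else 0) \<partial>lborel \<partial>lborel)"
  proof (rule nn_integral_mono)
    fix x
    show "P x * ennreal ((f x)\<^sup>2) * indicator I x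
      \<le> (\<integral>\<^sup>+t. 2 * P x * W x * A t * (if x < t then 1 else 0) \<partial>lborel)"
    proof (cases "x \<in> I")
      case True
      then have "P x * ennreal ((f x)\<^sup>2) \<le> P x * (2 * W x * (\<integral>\<^sup>+t. A t * indicator {x<..} t \<partial>lborel))"
        by (intro mult_left_mono pointwise) auto
      also have "\<dots> = (\<integral>\<^sup>+t. 2 * P x * W x * (A t * indicator {x<..} t) \<partial>lborel)"
        by (subst nn_integral_cmult) (auto simp: ac_simps)
      also have "\<dots> = (\<integral>\<^sup>+t. 2 * P x * W x * A t * (if x < t then 1 else 0) \<partial>lborel)"
        by (intro nn_integral_cong) (auto simp: ac_simps split: split_indicator)
      finally show ?thesis using True by simp
    qed simp
  qed
  also have "\<dots> = (\<integral>\<^sup>+t. \<integral>\<^sup>+x. 2 * P x * W x * A t * (if x < t then 1 else 0) \<partial>lborel \<partial>lborel)"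
    by (rule lborel_pair.Fubini') measurable
  also have "\<dots> = (\<integral>\<^sup>+t. 2 * A t * (\<integral>\<^sup>+x. P x * W x * indicator {..<t} x \<partial>lborel) \<partial>lborel)"
    by (subst nn_integral_cmult[symmetric])
      (auto intro!: nn_integral_cong simp: ac_simps split: split_indicator)
  also have "\<dots> \<le> (\<integral>\<^sup>+t. ennreal (4 * \<delta>) * (ennreal ((g t)\<^sup>2 / q t) * indicator I t) \<partial>lborel)"
  proof (rule nn_integral_mono)
    fix t
    show "2 * A t * (\<integral>\<^sup>+x. P x * W x * indicator {..<t} x \<partial>lborel)
      \<le> ennreal (4 * \<delta>) * (ennreal ((g t)\<^sup>2 / q t) * indicator I t)"
    proof (cases "t \<in> I")
      case True
      then have "2 * A t * (\<integral>\<^sup>+x. P x * W x * indicator {..<t} x \<partial>lborel)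
        \<le> 2 * A t * ennreal (2 * \<delta> / sqrt (N t))"
        by (intro mult_left_mono weight) auto
      also have "\<dots> = ennreal (4 * \<delta>) * ennreal ((g t)\<^sup>2 / q t)"
        using True q(2)[of t] N(2)[of t] \<open>0 \<le> \<delta>\<close>
        by (simp add: A_def flip: ennreal_mult ennreal_numeral)
      finally show ?thesis using True by simp
    qed (simp add: A_def)
  qed
  also have "\<dots> = ennreal (4 * \<delta>) * (\<integral>\<^sup>+t\<in>I. ennreal ((g t)\<^sup>2 / q t) \<partial>lborel)"
    using g q(1) nz(2) by (intro nn_integral_cmult)
      (auto intro!: borel_measurable_ennreal_indicator continuous_intros)
  finally show ?thesis .
qed

section \<open>The mixed eigenvalue problem\<close>

text \<open>
  The hypotheses under which the variational problem is studied; positivity of \<open>a\<close> is only known in the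
  open interval, so all densities below carry its indicator.
\<close>

locale mixed_eigenvalue_problem =
  fixes D :: ereal and a b :: "real \<Rightarrow> real"
  assumes D_pos: "0 < D"
    and a_measurable: "a \<in> borel_measurable (restrict_space borel (closed_ival D))"
    and a_pos: "\<And>x. x \<in> einterval 0 D \<Longrightarrow> 0 < a x"
    and drift_integrable: "locally_integrable_on (closed_ival D) (\<lambda>x. b x / a x)"
    and speed_integrable: "locally_integrable_on (closed_ival D) (\<lambda>x. exp (Cfun a b x) / a x)"
begin

abbreviation I :: "real set" where
  "I \<equiv> einterval 0 D"

abbreviation q :: "real \<Rightarrow> real" where
  "q x \<equiv> exp (- Cfun a b x)"

text \<open>
  The density of \<open>\<mu>\<close> (in the language of diffusions, of the speed measure), extended by \<open>0\<close>; the
  function \<open>q\<close> is the density of the scale measure \<open>\<nu>\<close> inside the interval.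
\<close>

definition P :: "real \<Rightarrow> ennreal" where
  "P x = ennreal (exp (Cfun a b x) / a x) * indicator I x"

abbreviation M :: "real \<Rightarrow> ennreal" where
  "M x \<equiv> emeasure (mu a b D) (einterval 0 (ereal x))"

abbreviation N :: "real \<Rightarrow> ennreal" where
  "N x \<equiv> emeasure (nu a b D) (einterval (ereal x) D)"

lemma Icc_subset_closed_ival: "ereal z \<le> D \<Longrightarrow> {0..z} \<subseteq> closed_ival D"
  by (auto simp: closed_ival_def intro: order_trans[of _ "ereal z"])

lemma I_subset_closed_ival: "I \<subseteq> closed_ival D"
  by (auto simp: closed_ival_def einterval_iff)

lemma mem_IE:
  assumes "x \<in> I"
  obtains z where "0 < x" "x < z" "ereal z < D"
  using assms ereal_dense2[of "ereal x" D] by (auto simp: einterval_iff)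

lemma head: "x \<in> I \<Longrightarrow> einterval 0 (ereal x) = I \<inter> {..<x}"
  by (auto simp: einterval_iff dest: less_trans[of "ereal _" "ereal x" D, unfolded less_ereal.simps(1)])

lemma tail: "x \<in> I \<Longrightarrow> einterval (ereal x) D = I \<inter> {x<..}"
  by (auto simp: einterval_iff zero_ereal_def)

lemma Icc_subset_I:
  assumes "x \<in> I" "y \<in> I"
  shows "{x..y} \<subseteq> I"
proof
  fix t assume "t \<in> {x..y}"
  then show "t \<in> I"
    using assms le_less_trans[of "ereal t" "ereal y" D] by (auto simp: einterval_iff zero_ereal_def)
qed

lemma continuous_on_Cfun_Icc:
  assumes "ereal z \<le> D"
  shows "continuous_on {0..z} (Cfun a b)"
proof -
  have int: "set_integrable lborel {0..z} (\<lambda>x. b x / a x)"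
    using drift_integrable Icc_subset_closed_ival[OF assms] by (auto simp: locally_integrable_on_def)
  have "continuous_on {0..z} (\<lambda>x. integral {0..x} (\<lambda>x. b x / a x))"
    by (intro indefinite_integral_continuous_1 set_borel_integral_eq_integral(1)[OF int])
  moreover have "integral {0..x} (\<lambda>x. b x / a x) = Cfun a b x" if "x \<in> {0..z}" for x
  proof -
    have "set_integrable lborel {0..x} (\<lambda>x. b x / a x)"
      using int by (rule set_integrable_subset) (use that in auto)
    then show ?thesis
      using that interval_integral_eq_integral[of 0 x "\<lambda>x. b x / a x"]
      by (simp add: Cfun_def zero_ereal_def)
  qed
  ultimately show ?thesis by (rule continuous_on_eq)
qed

lemma continuous_on_Cfun: "continuous_on I (Cfun a b)"
proof (rule continuous_at_imp_continuous_on, rule ballI)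
  fix x assume "x \<in> I"
  then obtain z where "0 < x" "x < z" "ereal z < D" by (rule mem_IE)
  then show "isCont (Cfun a b) x"
    by (intro continuous_on_interior[OF continuous_on_Cfun_Icc[of z]]) auto
qed

lemma continuous_on_q: "continuous_on I q"
  by (intro continuous_intros continuous_on_Cfun)

text \<open>
  Nothing is known about \<open>a\<close> off the closed interval, so it becomes a Borel function on the line only
  after multiplication with an indicator.
\<close>

lemma borel_measurable_a: "(\<lambda>x. a x * indicator I x) \<in> borel_measurable borel"
proof -
  have "closed_ival D = {0..} \<inter> ereal -` {..D}" by (auto simp: closed_ival_def)
  also have "\<dots> \<in> sets borel" by measurable
  finally have [measurable]: "closed_ival D \<in> sets borel" .
  have [measurable]: "(\<lambda>x. a x * indicator (closed_ival D) x) \<in> borel_measurable borel"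
    using a_measurable borel_measurable_restrict_space_iff[of "closed_ival D" borel a]
    by (simp add: mult.commute)
  have "(\<lambda>x. a x * indicator (closed_ival D) x * indicator I x) \<in> borel_measurable borel"
    by measurable
  also have "(\<lambda>x. a x * indicator (closed_ival D) x * indicator I x) = (\<lambda>x. a x * indicator I x)"
    using I_subset_closed_ival by (auto simp: fun_eq_iff split: split_indicator)
  finally show ?thesis .
qed

lemma borel_measurable_P[measurable]: "P \<in> borel_measurable borel"
proof -
  have [measurable]: "(\<lambda>x. ennreal (exp (Cfun a b x)) * indicator I x) \<in> borel_measurable borel"
    by (intro borel_measurable_ennreal_indicator continuous_intros continuous_on_Cfun) simp
  note [measurable] = borel_measurable_a
  have "(\<lambda>x. (ennreal (exp (Cfun a b x)) * indicator I x) * ennreal (1 / (a x * indicator I x)))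
    \<in> borel_measurable borel"
    by measurable
  moreover have "(ennreal (exp (Cfun a b x)) * indicator I x) * ennreal (1 / (a x * indicator I x)) = P x" for x
    using a_pos[of x] by (auto simp: P_def simp flip: ennreal_mult split: split_indicator)
  ultimately show ?thesis by simp
qed

lemma mu_eq: "mu a b D = density lborel P"
  by (simp add: mu_def P_def[abs_def])

text \<open>
  The usual rule for densities asks for a Borel integrand on the whole line. Trial functions and the
  coefficient \<open>a\<close> are only controlled in the interval, which is enough as \<open>\<mu>\<close> does not charge its
  complement.
\<close>

lemma nn_integral_mu:
  assumes "(\<lambda>x. g x * indicator I x) \<in> borel_measurable borel"
  shows "(\<integral>\<^sup>+x. g x \<partial>mu a b D) = (\<integral>\<^sup>+x\<in>I. P x * g x \<partial>lborel)"
proof -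
  have "(\<integral>\<^sup>+x. g x \<partial>mu a b D) = (\<integral>\<^sup>+x. g x * indicator I x \<partial>mu a b D)"
  proof (rule nn_integral_cong_AE)
    show "AE x in mu a b D. g x = g x * indicator I x"
      unfolding mu_eq by (subst AE_density) (auto simp: P_def split: split_indicator)
  qed
  also have "\<dots> = (\<integral>\<^sup>+x. P x * (g x * indicator I x) \<partial>lborel)"
    unfolding mu_eq using assms by (intro nn_integral_density) auto
  finally show ?thesis by (simp add: mult.assoc)
qed

lemma emeasure_mu: "S \<in> sets borel \<Longrightarrow> emeasure (mu a b D) S = (\<integral>\<^sup>+x\<in>S. P x \<partial>lborel)"
  unfolding mu_eq by (intro emeasure_density) auto

lemma nu_density_measurable: "(\<lambda>x. ennreal (q x) * indicator I x) \<in> borel_measurable borel"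
  by (intro borel_measurable_ennreal_indicator continuous_on_q) simp

lemma emeasure_nu: "x \<in> I \<Longrightarrow> N x = (\<integral>\<^sup>+t\<in>einterval (ereal x) D. ennreal (q t) \<partial>lborel)"
  unfolding nu_def using nu_density_measurable
  by (subst emeasure_density) (auto intro!: nn_integral_cong simp: tail split: split_indicator)

lemma M_finite:
  assumes "ereal z \<le> D"
  shows "M z < \<infinity>"
proof -
  have "set_integrable lborel {0..z} (\<lambda>x. exp (Cfun a b x) / a x)"
    using speed_integrable Icc_subset_closed_ival[OF assms] by (auto simp: locally_integrable_on_def)
  then have "(\<integral>\<^sup>+x. norm (indicator {0..z} x *\<^sub>R (exp (Cfun a b x) / a x)) \<partial>lborel) < \<infinity>"
    by (simp add: set_integrable_def integrable_iff_bounded)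
  moreover have "M z \<le> (\<integral>\<^sup>+x. norm (indicator {0..z} x *\<^sub>R (exp (Cfun a b x) / a x)) \<partial>lborel)"
    unfolding emeasure_mu[OF borel_einterval]
    by (intro nn_integral_mono)
      (auto simp: P_def einterval_iff abs_mult less_imp_le[OF a_pos] intro!: ennreal_leI split: split_indicator)
  ultimately show ?thesis by (rule le_less_trans[rotated])
qed

lemma M_pos:
  assumes "x \<in> I"
  shows "0 < M x"
proof (rule ccontr)
  assume "\<not> 0 < M x"
  then have "(\<integral>\<^sup>+t\<in>einterval 0 (ereal x). P t \<partial>lborel) = 0"
    by (simp add: emeasure_mu)
  then have "AE t in lborel. P t * indicator (einterval 0 (ereal x)) t = 0"
    by (subst (asm) nn_integral_0_iff_AE) auto
  then have "AE t in lborel. t \<notin> {0<..<x}"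
  proof eventually_elim
    case (elim t)
    then show ?case
      using a_pos[of t] assms by (auto simp: P_def head einterval_iff zero_ereal_def
          split: split_indicator_asm intro: less_trans[of _ "ereal x" D])
  qed
  then have "emeasure lborel {0<..<x} = 0"
    by (subst (asm) AE_iff_measurable[OF _ refl]) (auto simp: greaterThanLessThan_def greaterThan_def lessThan_def Int_def)
  then show False using assms by (auto simp: einterval_iff)
qed

lemma C_K_continuous: "f \<in> C_K D \<Longrightarrow> continuous_on I f"
  using I_subset_closed_ival by (auto simp: C_K_def intro: continuous_on_subset)

lemma C_K_deriv:
  assumes "f \<in> C_K D"
  shows "x \<in> I \<Longrightarrow> (f has_real_derivative deriv f x) (at x)" and "continuous_on I (deriv f)"
proof -
  obtain f' where f': "\<And>x. x \<in> I \<Longrightarrow> (f has_real_derivative f' x) (at x)" "continuous_on I f'"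
    using assms by (auto simp: C_K_def C1_differentiable_on_def has_real_derivative_iff_has_vector_derivative)
  have eq: "deriv f x = f' x" if "x \<in> I" for x
    using f'(1)[OF that] by (rule DERIV_imp_deriv)
  show "x \<in> I \<Longrightarrow> (f has_real_derivative deriv f x) (at x)"
    using f'(1) eq by simp
  show "continuous_on I (deriv f)"
    using f'(2) eq by (simp cong: continuous_on_cong)
qed

lemma mu_square:
  assumes "f \<in> C_K D"
  shows "(\<integral>\<^sup>+x. ennreal ((f x)\<^sup>2) \<partial>mu a b D) = (\<integral>\<^sup>+x\<in>I. P x * ennreal ((f x)\<^sup>2) \<partial>lborel)"
  by (intro nn_integral_mu borel_measurable_ennreal_indicator continuous_intros C_K_continuous assms) simp

lemma dirichlet_form_eq:
  assumes "f \<in> C_K D"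
  shows "dirichlet_form a b D f = (\<integral>\<^sup>+x\<in>I. ennreal ((deriv f x)\<^sup>2 / q x) \<partial>lborel)"
proof -
  note [measurable] = borel_measurable_a
  have [measurable]: "(\<lambda>x. ennreal ((deriv f x)\<^sup>2) * indicator I x) \<in> borel_measurable borel"
    by (intro borel_measurable_ennreal_indicator continuous_intros C_K_deriv assms) simp
  have "(\<lambda>x. ennreal (a x * indicator I x) * (ennreal ((deriv f x)\<^sup>2) * indicator I x)) \<in> borel_measurable borel"
    by measurable
  also have "(\<lambda>x. ennreal (a x * indicator I x) * (ennreal ((deriv f x)\<^sup>2) * indicator I x))
      = (\<lambda>x. ennreal (a x * (deriv f x)\<^sup>2) * indicator I x)"
    using a_pos by (auto simp: fun_eq_iff less_imp_le simp flip: ennreal_mult split: split_indicator)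
  finally have "dirichlet_form a b D f = (\<integral>\<^sup>+x\<in>I. P x * ennreal (a x * (deriv f x)\<^sup>2) \<partial>lborel)"
    unfolding dirichlet_form_def by (rule nn_integral_mu)
  also have "\<dots> = (\<integral>\<^sup>+x\<in>I. ennreal ((deriv f x)\<^sup>2 / q x) \<partial>lborel)"
    using a_pos by (intro nn_integral_cong)
      (auto simp: P_def less_imp_le less_imp_neq[symmetric] exp_minus field_simps simp flip: ennreal_mult
        split: split_indicator)
  finally show ?thesis .
qed

text \<open>
  Dividing a trial function by its \<open>L\<^sup>2(\<mu>)\<close> norm makes it admissible in the infimum. The product form
  avoids quotients of extended nonnegative reals.
\<close>

lemma lambda0_mult_le:
  assumes f: "f \<in> C_K D" and "D < \<infinity> \<Longrightarrow> f (real_of_ereal D) = 0"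
    and pos: "0 < (\<integral>\<^sup>+x. ennreal ((f x)\<^sup>2) \<partial>mu a b D)"
    and fin: "(\<integral>\<^sup>+x. ennreal ((f x)\<^sup>2) \<partial>mu a b D) < \<infinity>"
  shows "lambda0 a b D * (\<integral>\<^sup>+x. ennreal ((f x)\<^sup>2) \<partial>mu a b D) \<le> dirichlet_form a b D f"
proof -
  obtain m where m: "(\<integral>\<^sup>+x. ennreal ((f x)\<^sup>2) \<partial>mu a b D) = ennreal m" "0 < m"
    using pos fin by (cases "\<integral>\<^sup>+x. ennreal ((f x)\<^sup>2) \<partial>mu a b D") auto
  define h where "h x = f x / sqrt m" for x
  have dh: "(h has_real_derivative deriv f x / sqrt m) (at x)" if "x \<in> I" for x
    unfolding h_def using C_K_deriv(1)[OF f that] by (rule DERIV_cdivide)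
  have supp: "{x \<in> closed_ival D. h x \<noteq> 0} = {x \<in> closed_ival D. f x \<noteq> 0}"
    using m(2) by (auto simp: h_def)
  have "h C1_differentiable_on I"
    unfolding C1_differentiable_on_def has_real_derivative_iff_has_vector_derivative[symmetric]
    using dh m(2)
    by (intro exI[of _ "\<lambda>x. deriv f x / sqrt m"] conjI ballI continuous_intros C_K_deriv f) auto
  moreover have "continuous_on (closed_ival D) h"
    unfolding h_def using f m(2) by (intro continuous_intros) (auto simp: C_K_def)
  ultimately have h: "h \<in> C_K D"
    using f by (simp add: C_K_def supp)
  have scale: "ennreal ((f x)\<^sup>2 / m) = ennreal (1 / m) * ennreal ((f x)\<^sup>2)" for x
    using m(2) by (simp flip: ennreal_mult)
  have "(\<integral>\<^sup>+x. ennreal ((h x)\<^sup>2) \<partial>mu a b D) = (\<integral>\<^sup>+x. ennreal (1 / m) * (P x * ennreal ((f x)\<^sup>2) * indicator I x) \<partial>lborel)"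
    unfolding mu_square[OF h] using m(2)
    by (intro nn_integral_cong)
      (auto simp: h_def power_divide scale ac_simps split: split_indicator)
  also have "\<dots> = ennreal (1 / m) * (\<integral>\<^sup>+x. ennreal ((f x)\<^sup>2) \<partial>mu a b D)"
  proof -
    have [measurable]: "(\<lambda>x. ennreal ((f x)\<^sup>2) * indicator I x) \<in> borel_measurable borel"
      by (intro borel_measurable_ennreal_indicator continuous_intros C_K_continuous f) simp
    show ?thesis
      unfolding mu_square[OF f] by (subst nn_integral_cmult) (auto simp: mult.assoc)
  qed
  also have "\<dots> = 1" using m by (simp flip: ennreal_mult)
  finally have norm: "(\<integral>\<^sup>+x. ennreal ((h x)\<^sup>2) \<partial>mu a b D) = 1" .
  have "dirichlet_form a b D h = (\<integral>\<^sup>+x. ennreal (1 / m) * (ennreal ((deriv f x)\<^sup>2 / q x) * indicator I x) \<partial>lborel)"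
    unfolding dirichlet_form_eq[OF h] using m(2)
    by (intro nn_integral_cong)
      (auto simp: DERIV_imp_deriv[OF dh] power_divide ennreal_mult[symmetric] ac_simps split: split_indicator)
  also have "\<dots> = ennreal (1 / m) * dirichlet_form a b D f"
    unfolding dirichlet_form_eq[OF f]
    by (subst nn_integral_cmult)
      (auto intro!: borel_measurable_ennreal_indicator continuous_intros C_K_deriv f continuous_on_Cfun)
  finally have form: "dirichlet_form a b D h = ennreal (1 / m) * dirichlet_form a b D f" .
  have "lambda0 a b D \<le> dirichlet_form a b D h"
    unfolding lambda0_def using h norm assms(2) by (intro Inf_lower) (auto simp: h_def)
  then have "lambda0 a b D * ennreal m \<le> ennreal (1 / m) * dirichlet_form a b D f * ennreal m"
    unfolding form by (rule mult_right_mono) simp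
  also have "\<dots> = ennreal (1 / m * m) * dirichlet_form a b D f"
    using m(2) by (subst ennreal_mult) (auto simp: ac_simps)
  also have "\<dots> = dirichlet_form a b D f" using m(2) by simp
  finally show ?thesis by (simp add: m(1))
qed

section \<open>Upper bound by trial functions\<close>

text \<open>
  The trial function is \<open>F y = \<integral>\<^sub>y\<^sup>D \<phi> q\<close>. It is constant, equal to \<open>S = \<integral> \<phi> q\<close>, to the left of \<open>x\<close>, so
  \<open>\<mu>(F\<^sup>2) \<ge> M x S\<^sup>2\<close>; and \<open>\<phi>\<^sup>2 \<le> \<phi>\<close> bounds its energy \<open>\<integral> \<phi>\<^sup>2 q\<close> by \<open>S\<close>. Dividing by \<open>S\<close> gives the
  claim.
\<close>

lemma lambda0_mult_cutoff_le:
  fixes \<phi> :: "real \<Rightarrow> real"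
  assumes x: "x \<in> I"
    and \<phi>: "continuous_on UNIV \<phi>" "\<And>t. 0 \<le> \<phi> t" "\<And>t. \<phi> t \<le> 1"
      "\<And>t. t \<le> x \<Longrightarrow> \<phi> t = 0" "\<And>t. m \<le> t \<Longrightarrow> \<phi> t = 0"
  shows "lambda0 a b D * (M x * (\<integral>\<^sup>+t\<in>I. ennreal (\<phi> t * q t) \<partial>lborel)) \<le> 1"
proof -
  \<comment> \<open>A finite endpoint for the trial function: \<open>D\<close> itself, or a point beyond the support of \<open>\<phi>\<close> if \<open>D = \<infinity>\<close>.\<close>
  obtain z where z: "x < z" "ereal z \<le> D" "D < \<infinity> \<Longrightarrow> D = ereal z" "D = \<infinity> \<Longrightarrow> m \<le> z"
  proof (cases "D < \<infinity>")
    case True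
    then obtain d where "D = ereal d" using D_pos by (cases D) auto
    then show ?thesis using x by (intro that[of d]) (auto simp: einterval_iff)
  next
    case False
    then show ?thesis by (intro that[of "max m (x + 1)"]) auto
  qed
  have x0: "0 < x" using x by (auto simp: einterval_iff)
  have beyond: "\<phi> t = 0" if "z \<le> t" "t \<in> closed_ival D" "t \<noteq> z" for t
  proof -
    have "D = \<infinity>" using z(3) that by (cases "D < \<infinity>") (auto simp: closed_ival_def)
    then show ?thesis using z(4) that \<phi>(5) by auto
  qed
  \<comment> \<open>Clamping the argument of \<open>q\<close> extends \<open>\<phi> q\<close> to a continuous function on the line, so that its
      antiderivative is \<open>C\<^sup>1\<close> everywhere and the endpoints need no separate treatment.\<close>
  define h where "h t = \<phi> t * q (max 0 (min t z))" for t
  have h_cont: "continuous_on UNIV h"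
  proof -
    have "continuous_on UNIV (\<lambda>t. Cfun a b (max 0 (min t z)))"
      by (rule continuous_on_compose2[OF continuous_on_Cfun_Icc[OF z(2)]])
        (use z x0 in \<open>auto intro!: continuous_intros\<close>)
    then show ?thesis unfolding h_def by (intro continuous_intros \<phi>)
  qed
  have h_nonneg: "0 \<le> h t" for t using \<phi>(2) by (simp add: h_def)
  have h_eq: "h t = \<phi> t * q t" if "t \<in> I" for t
  proof (cases "t \<le> z")
    case True
    then show ?thesis using that by (auto simp: h_def einterval_iff max_def min_def)
  next
    case False
    then have "\<phi> t = 0" using beyond[of t] that I_subset_closed_ival by auto
    then show ?thesis by (simp add: h_def)
  qed
  have "\<exists>G. \<forall>t::real. - \<infinity> < ereal t \<longrightarrow> ereal t < \<infinity> \<longrightarrow> (G has_vector_derivative h t) (at t)"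
    using h_cont by (intro einterval_antiderivative) (auto simp: continuous_on_eq_continuous_at)
  then obtain G where G_vec: "\<forall>t::real. - \<infinity> < ereal t \<longrightarrow> ereal t < \<infinity> \<longrightarrow> (G has_vector_derivative h t) (at t)"
    by (rule exE)
  have G: "(G has_real_derivative h t) (at t)" for t
    unfolding has_real_derivative_iff_has_vector_derivative using G_vec[rule_format, of t] by simp
  have G_mono: "G s \<le> G t" if "s \<le> t" for s t
  proof (rule DERIV_nonneg_imp_nondecreasing[OF that])
    show "\<exists>y. (G has_real_derivative y) (at r) \<and> 0 \<le> y" for r
      using G[of r] h_nonneg[of r] by (intro exI conjI)
  qed
  have G_const: "G t = G s" if "s \<le> t" "\<And>r. s < r \<Longrightarrow> r < t \<Longrightarrow> \<phi> r = 0" for s t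
  proof (cases "s = t")
    case False
    have "continuous_on {s..t} G"
      using G by (meson DERIV_isCont continuous_at_imp_continuous_on)
    moreover have "(G has_real_derivative 0) (at r)" if "s < r" "r < t" for r
      using G[of r] \<open>\<And>r. s < r \<Longrightarrow> r < t \<Longrightarrow> \<phi> r = 0\<close>[OF that] by (simp add: h_def)
    ultimately show ?thesis using False \<open>s \<le> t\<close> by (intro DERIV_isconst_end) auto
  qed simp
  define F where "F y = G z - G y" for y
  define S where "S = F x"
  have dF: "(F has_real_derivative - h t) (at t)" for t
    unfolding F_def using G by (auto intro!: derivative_eq_intros)
  have F_left: "F y = S" if "y \<le> x" for y
    using G_const[of y x] that \<phi>(4) by (simp add: F_def S_def)
  have F_right: "F y = 0" if "z \<le> y" "y \<in> closed_ival D" for y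
  proof -
    have "\<phi> r = 0" if "z < r" "r < y" for r
    proof (rule beyond)
      show "r \<in> closed_ival D"
        using that \<open>y \<in> closed_ival D\<close> x0 z(1) order_trans[of "ereal r" "ereal y" D]
        by (auto simp: closed_ival_def)
    qed (use that in auto)
    then show ?thesis using G_const[of z y] that by (simp add: F_def)
  qed
  have F_bounds: "0 \<le> F y" "F y \<le> S" if "y \<in> closed_ival D" for y
  proof -
    show "0 \<le> F y"
    proof (cases "z \<le> y")
      case True
      then show ?thesis using F_right[OF True that] by linarith
    next
      case False
      then show ?thesis using G_mono[of y z] unfolding F_def by linarith
    qed
    show "F y \<le> S"
    proof (cases "y \<le> x")
      case True
      then show ?thesis using F_left[OF True] by linarith
    next
      case False
      then show ?thesis using G_mono[of x y] unfolding F_def S_def by linarith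
    qed
  qed
  have S: "ennreal S = (\<integral>\<^sup>+t\<in>I. ennreal (\<phi> t * q t) \<partial>lborel)"
  proof -
    have "ennreal S = (\<integral>\<^sup>+t\<in>{x<..<z}. ennreal (h t) \<partial>lborel)"
      unfolding S_def F_def using z(1) G h_nonneg continuous_on_subset[OF h_cont]
      by (intro nn_integral_FTC_Ioo[symmetric]) auto
    also have "\<dots> = (\<integral>\<^sup>+t\<in>I. ennreal (\<phi> t * q t) \<partial>lborel)"
    proof (rule nn_integral_cong_AE)
      show "AE t in lborel. ennreal (h t) * indicator {x<..<z} t = ennreal (\<phi> t * q t) * indicator I t"
        using AE_lborel_singleton[of z]
      proof eventually_elim
        case (elim t)
        consider "t \<le> x" | "x < t" "t < z" | "z < t" using elim by linarith
        then show ?case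
        proof cases
          case 1
          then show ?thesis using \<phi>(4) by simp
        next
          case 2
          then have "ereal t < D" using z(2) by (intro less_le_trans[of "ereal t" "ereal z" D]) auto
          then have "t \<in> I" using 2 x0 by (auto simp: einterval_iff)
          then show ?thesis using 2 h_eq by simp
        next
          case 3
          then show ?thesis
            using beyond[of t] I_subset_closed_ival by (auto split: split_indicator)
        qed
      qed
    qed
    finally show ?thesis .
  qed
  have F: "F \<in> C_K D"
  proof -
    have "F C1_differentiable_on I"
      unfolding C1_differentiable_on_def has_real_derivative_iff_has_vector_derivative[symmetric]
      using dF continuous_on_subset[OF h_cont] by (intro exI[of _ "\<lambda>t. - h t"]) (auto intro: continuous_on_minus)
    moreover have "continuous_on (closed_ival D) F"
      using dF by (meson DERIV_isCont continuous_at_imp_continuous_on)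
    moreover have "{y \<in> closed_ival D. F y \<noteq> 0} \<subseteq> {0..z}"
    proof
      fix y assume "y \<in> {y \<in> closed_ival D. F y \<noteq> 0}"
      then show "y \<in> {0..z}"
        using F_right[of y] by (cases "y \<le> z") (auto simp: closed_ival_def)
    qed
    then have "compact (closure {y \<in> closed_ival D. F y \<noteq> 0})"
      by (meson bounded_closed_interval bounded_subset compact_closure)
    ultimately show ?thesis by (simp add: C_K_def)
  qed
  show ?thesis
  proof (cases "S = 0")
    case True
    then show ?thesis by (simp add: S[symmetric])
  next
    case False
    then have S_pos: "0 < S"
      using F_bounds(1)[of x] x I_subset_closed_ival by (auto simp: S_def)
    have lower: "M x * ennreal (S\<^sup>2) \<le> (\<integral>\<^sup>+y. ennreal ((F y)\<^sup>2) \<partial>mu a b D)"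
    proof -
      have "M x * ennreal (S\<^sup>2) = (\<integral>\<^sup>+y. P y * indicator (einterval 0 (ereal x)) y * ennreal (S\<^sup>2) \<partial>lborel)"
        by (simp add: emeasure_mu nn_integral_multc)
      also have "\<dots> \<le> (\<integral>\<^sup>+y\<in>I. P y * ennreal ((F y)\<^sup>2) \<partial>lborel)"
        using x F_left by (intro nn_integral_mono) (auto simp: head split: split_indicator)
      finally show ?thesis by (simp add: mu_square[OF F])
    qed
    have upper: "(\<integral>\<^sup>+y. ennreal ((F y)\<^sup>2) \<partial>mu a b D) \<le> M z * ennreal (S\<^sup>2)"
    proof -
      have "(\<integral>\<^sup>+y\<in>I. P y * ennreal ((F y)\<^sup>2) \<partial>lborel)
        \<le> (\<integral>\<^sup>+y. P y * indicator (einterval 0 (ereal z)) y * ennreal (S\<^sup>2) \<partial>lborel)"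
      proof (rule nn_integral_mono)
        fix y
        show "P y * ennreal ((F y)\<^sup>2) * indicator I y \<le> P y * indicator (einterval 0 (ereal z)) y * ennreal (S\<^sup>2)"
        proof (cases "y \<in> I \<and> y < z")
          case True
          then have "(F y)\<^sup>2 \<le> S\<^sup>2"
            using F_bounds[of y] I_subset_closed_ival by (intro power_mono) auto
          then have "P y * ennreal ((F y)\<^sup>2) \<le> P y * ennreal (S\<^sup>2)"
            by (intro mult_left_mono ennreal_leI) simp_all
          moreover have "y \<in> einterval 0 (ereal z)" using True by (auto simp: einterval_iff)
          ultimately show ?thesis using True by simp
        next
          case False
          then show ?thesis
            using F_right[of y] I_subset_closed_ival by (cases "y \<in> I") auto
        qed
      qed
      also have "\<dots> = M z * ennreal (S\<^sup>2)"
        by (simp add: emeasure_mu nn_integral_multc)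
      finally show ?thesis by (simp add: mu_square[OF F])
    qed
    have "0 < M x * ennreal (S\<^sup>2)"
      using M_pos[OF x] S_pos by (simp add: ennreal_zero_less_mult_iff)
    then have "0 < (\<integral>\<^sup>+y. ennreal ((F y)\<^sup>2) \<partial>mu a b D)"
      using lower by (rule less_le_trans)
    moreover have "M z * ennreal (S\<^sup>2) < \<infinity>"
      using M_finite[OF z(2)] by (simp add: ennreal_mult_less_top)
    then have "(\<integral>\<^sup>+y. ennreal ((F y)\<^sup>2) \<partial>mu a b D) < \<infinity>"
      using upper by (rule le_less_trans[rotated])
    moreover have "F (real_of_ereal D) = 0" if "D < \<infinity>"
      using z(3)[OF that] by (simp add: F_def)
    ultimately have "lambda0 a b D * (\<integral>\<^sup>+y. ennreal ((F y)\<^sup>2) \<partial>mu a b D) \<le> dirichlet_form a b D F"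
      by (intro lambda0_mult_le F)
    also have "\<dots> \<le> ennreal S"
      unfolding dirichlet_form_eq[OF F] S
    proof (rule nn_integral_mono)
      fix t
      show "ennreal ((deriv F t)\<^sup>2 / q t) * indicator I t \<le> ennreal (\<phi> t * q t) * indicator I t"
      proof (cases "t \<in> I")
        case True
        have "\<phi> t * \<phi> t \<le> \<phi> t * 1"
          using \<phi>(2,3) by (intro mult_left_mono)
        then have "\<phi> t * \<phi> t * q t \<le> \<phi> t * 1 * q t"
          by (rule mult_right_mono) simp
        then have "(\<phi> t * q t)\<^sup>2 / q t \<le> \<phi> t * q t"
          by (simp add: power2_eq_square ac_simps)
        then show ?thesis
          using True by (simp add: DERIV_imp_deriv[OF dF] h_eq ennreal_leI)
      qed simp
    qed
    finally have "lambda0 a b D * (\<integral>\<^sup>+y. ennreal ((F y)\<^sup>2) \<partial>mu a b D) \<le> ennreal S" .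
    then have "lambda0 a b D * (M x * ennreal (S\<^sup>2)) \<le> ennreal S"
      using lower by (meson mult_left_mono order_trans zero_le)
    then have "lambda0 a b D * (M x * ennreal (S\<^sup>2)) * ennreal (1 / S) \<le> ennreal S * ennreal (1 / S)"
      by (rule mult_right_mono) simp
    moreover have "ennreal (S\<^sup>2) * ennreal (1 / S) = ennreal S" "ennreal S * ennreal (1 / S) = 1"
      using S_pos by (auto simp: power2_eq_square simp flip: ennreal_mult)
    ultimately show ?thesis by (simp add: S[symmetric] mult.assoc)
  qed
qed

lemma lambda0_mult_M_N_le:
  assumes x: "x \<in> I"
  shows "lambda0 a b D * (M x * N x) \<le> 1"
proof -
  \<comment> \<open>The first factor rises from \<open>0\<close> at \<open>x\<close> with slope \<open>n\<close>, the second falls to \<open>0\<close> on \<open>[n - 1, n]\<close>;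
      both increase with \<open>n\<close>.\<close>
  define \<phi> where "\<phi> n t = min 1 (max 0 (real n * (t - x))) * min 1 (max 0 (real n - t))" for n :: nat and t
  have ramp: "max 0 (real n * (t - x)) = 0" if "t \<le> x" for n t
    using that by (intro max_absorb1) (simp add: mult_le_0_iff)
  have \<phi>_left: "\<phi> n t = 0" if "t \<le> x" for n t
    using ramp[OF that] by (simp add: \<phi>_def)
  have \<phi>_cont: "continuous_on S (\<phi> n)" for S n
    unfolding \<phi>_def by (intro continuous_intros)
  have \<phi>_mono: "\<phi> i t \<le> \<phi> j t" if "i \<le> j" for i j t
  proof -
    have "max 0 (real i * (t - x)) \<le> max 0 (real j * (t - x))"
    proof (cases "t \<le> x")
      case False
      then have "real i * (t - x) \<le> real j * (t - x)" using that by (intro mult_right_mono) auto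
      then show ?thesis by (intro max.mono) auto
    qed (simp add: ramp)
    then show ?thesis
      using that unfolding \<phi>_def by (intro mult_mono) auto
  qed
  have \<phi>_SUP: "(SUP n. ennreal (\<phi> n t * q t) * indicator I t) = ennreal (q t) * indicator (einterval (ereal x) D) t" for t
  proof (cases "t \<in> I \<and> x < t")
    case True
    have le: "\<phi> n t \<le> 1" for n unfolding \<phi>_def by (intro mult_le_one) auto
    obtain n where n: "max (1 / (t - x)) (t + 1) \<le> real n" using real_arch_simple by blast
    then have "1 \<le> real n * (t - x)" using True by (simp add: field_simps)
    then have "\<phi> n t = 1" using n by (simp add: \<phi>_def)
    then have "ennreal (q t) \<le> (SUP n. ennreal (\<phi> n t * q t))"
      by (intro SUP_upper2[of n]) auto
    moreover have "(SUP n. ennreal (\<phi> n t * q t)) \<le> ennreal (q t)"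
      using le by (intro SUP_least ennreal_leI) auto
    ultimately show ?thesis using True x by (simp add: tail)
  next
    case False
    then have "\<phi> n t = 0 \<or> t \<notin> I" for n
      using \<phi>_left by auto
    then have zero: "ennreal (\<phi> n t * q t) * indicator I t = 0" for n
      by (cases "t \<in> I") auto
    show ?thesis unfolding zero using False x by (simp add: tail)
  qed
  have "N x = (\<integral>\<^sup>+t. (SUP n. ennreal (\<phi> n t * q t) * indicator I t) \<partial>lborel)"
    by (simp add: emeasure_nu[OF x] \<phi>_SUP)
  also have "\<dots> = (SUP n. \<integral>\<^sup>+t\<in>I. ennreal (\<phi> n t * q t) \<partial>lborel)"
  proof (rule nn_integral_monotone_convergence_SUP)
    show "incseq (\<lambda>n t. ennreal (\<phi> n t * q t) * indicator I t)"
      using \<phi>_mono by (auto simp: incseq_def le_fun_def intro!: ennreal_leI split: split_indicator)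
    show "(\<lambda>t. ennreal (\<phi> n t * q t) * indicator I t) \<in> borel_measurable lborel" for n
      by (auto intro!: borel_measurable_ennreal_indicator continuous_intros continuous_on_Cfun \<phi>_cont)
  qed
  finally have "lambda0 a b D * (M x * N x)
      = (SUP n. lambda0 a b D * (M x * (\<integral>\<^sup>+t\<in>I. ennreal (\<phi> n t * q t) \<partial>lborel)))"
    by (simp add: SUP_mult_left_ennreal)
  also have "\<dots> \<le> 1"
  proof (rule SUP_least)
    fix n :: nat
    show "lambda0 a b D * (M x * (\<integral>\<^sup>+t\<in>I. ennreal (\<phi> n t * q t) \<partial>lborel)) \<le> 1"
    proof (rule lambda0_mult_cutoff_le[OF x, where m = "real n"])
      show "\<phi> n t \<le> 1" for t unfolding \<phi>_def by (intro mult_le_one) auto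
    qed (auto simp: \<phi>_cont \<phi>_left, auto simp: \<phi>_def)
  qed
  finally show ?thesis .
qed

lemma lambda0_mult_delta_le: "lambda0 a b D * delta a b D \<le> 1"
  unfolding delta_def by (auto simp: SUP_mult_left_ennreal intro!: SUP_least lambda0_mult_M_N_le)

section \<open>Lower bound by the Hardy inequality\<close>

text \<open>
  The Dirichlet condition enters here: \<open>f\<close> tends to \<open>0\<close> at a finite \<open>D\<close> by continuity, and vanishes
  near \<open>D = \<infinity>\<close> by compactness of the support.
\<close>

lemma abs_le_nn_integral_deriv:
  assumes f: "f \<in> C_K D" and bc: "D < \<infinity> \<Longrightarrow> f (real_of_ereal D) = 0" and x: "x \<in> I"
  shows "ennreal \<bar>f x\<bar> \<le> (\<integral>\<^sup>+t\<in>einterval (ereal x) D. ennreal \<bar>deriv f t\<bar> \<partial>lborel)"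
    (is "_ \<le> ?R")
proof -
  have increment: "ennreal \<bar>f y - f x\<bar> \<le> ?R" if y: "y \<in> I" "x < y" for y
  proof -
    have sub: "{x..y} \<subseteq> I"
      using x y by (intro Icc_subset_I)
    have "ennreal \<bar>f y - f x\<bar> \<le> (\<integral>\<^sup>+t\<in>{x..y}. ennreal \<bar>deriv f t\<bar> \<partial>lborel)"
      using sub y(2) by (intro nn_integral_abs_deriv_ge C_K_deriv(1)[OF f] continuous_on_subset[OF C_K_deriv(2)[OF f]]) auto
    also have "\<dots> \<le> ?R"
    proof (rule nn_integral_mono_AE)
      show "AE t in lborel. ennreal \<bar>deriv f t\<bar> * indicator {x..y} t
          \<le> ennreal \<bar>deriv f t\<bar> * indicator (einterval (ereal x) D) t"
        using AE_lborel_singleton[of x]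
        by eventually_elim (use sub in \<open>auto simp: tail[OF x] split: split_indicator\<close>)
    qed
    finally show ?thesis .
  qed
  show ?thesis
  proof (cases "D < \<infinity>")
    case False
    have "bounded {y \<in> closed_ival D. f y \<noteq> 0}"
      using f bounded_subset[OF compact_imp_bounded closure_subset] by (auto simp: C_K_def)
    then obtain B where B: "\<And>y. y \<in> closed_ival D \<Longrightarrow> f y \<noteq> 0 \<Longrightarrow> \<bar>y\<bar> \<le> B"
      by (auto simp: bounded_iff)
    define y where "y = max x B + 1"
    have "y \<in> I" "x < y" "B < \<bar>y\<bar>" using x False by (auto simp: einterval_iff y_def zero_ereal_def)
    then have "f y = 0" using B[of y] I_subset_closed_ival by force
    then show ?thesis using increment[OF \<open>y \<in> I\<close> \<open>x < y\<close>] by simp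
  next
    case True
    then obtain d where d: "D = ereal d" using D_pos by (cases D) auto
    have "0 < d" "x < d" using x D_pos by (auto simp: d einterval_iff)
    have "closed_ival D = {0..d}" by (auto simp: closed_ival_def d)
    then have "(f \<longlongrightarrow> f d) (at_left d)"
      using f \<open>0 < d\<close> by (intro continuous_on_Icc_at_leftD[of 0]) (auto simp: C_K_def)
    then have lim: "((\<lambda>y. ennreal \<bar>f y - f x\<bar>) \<longlongrightarrow> ennreal \<bar>f d - f x\<bar>) (at_left d)"
      by (intro tendsto_intros)
    have "\<forall>\<^sub>F y in at_left d. ennreal \<bar>f y - f x\<bar> \<le> ?R"
    proof (rule eventually_at_leftI[OF _ \<open>x < d\<close>])
      fix y assume "y \<in> {x<..<d}"
      then show "ennreal \<bar>f y - f x\<bar> \<le> ?R"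
        using x by (intro increment) (auto simp: einterval_iff d zero_ereal_def)
    qed
    then have "ennreal \<bar>f d - f x\<bar> \<le> ?R"
      using lim by (intro tendsto_upperbound[OF lim]) auto
    then show ?thesis using bc[OF True] by (simp add: d)
  qed
qed

text \<open>
  Finiteness of \<open>\<delta>\<close> forces \<open>N\<close> to be finite, since \<open>M > 0\<close> in the interval. Then \<open>N\<close> differs by a constant
  from minus an antiderivative of \<open>q\<close>, so it meets the requirements of the abstract inequality.
\<close>

lemma hardy_inequality:
  assumes fin: "delta a b D < \<infinity>"
    and f: "f \<in> C_K D" and bc: "D < \<infinity> \<Longrightarrow> f (real_of_ereal D) = 0"
  shows "(\<integral>\<^sup>+x. ennreal ((f x)\<^sup>2) \<partial>mu a b D) \<le> 4 * delta a b D * dirichlet_form a b D f"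
proof -
  obtain \<delta> where \<delta>: "delta a b D = ennreal \<delta>" "0 \<le> \<delta>"
    using fin by (cases "delta a b D") auto
  have MN: "M x * N x \<le> ennreal \<delta>" if "x \<in> I" for x
    unfolding \<delta>(1)[symmetric] delta_def using that by (rule SUP_upper)
  have N_fin: "N x < \<infinity>" if "x \<in> I" for x
  proof (rule ccontr)
    assume "\<not> N x < \<infinity>"
    then have "M x * N x = \<infinity>"
      using M_pos[OF that] by (simp add: ennreal_mult_top not_less top_unique)
    then show False using MN[OF that] by (simp add: top_unique)
  qed
  have "\<exists>G. \<forall>t::real. 0 < ereal t \<longrightarrow> ereal t < D \<longrightarrow> (G has_vector_derivative q t) (at t)"
    using continuous_on_q D_pos
    by (intro einterval_antiderivative) (auto simp: continuous_on_eq_continuous_at einterval_iff)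
  then obtain G where G: "\<And>t. t \<in> I \<Longrightarrow> (G has_real_derivative q t) (at t)"
    by (auto simp: has_real_derivative_iff_has_vector_derivative einterval_iff)
  define n where "n x = enn2real (N x)" for x
  have n_nonneg: "0 \<le> n x" for x by (simp add: n_def)
  have N_eq: "N x = ennreal (n x)" if "x \<in> I" for x
    using N_fin[OF that] by (simp add: n_def)
  have n_diff: "n s = G t - G s + n t \<and> G s < G t" if "s \<in> I" "t \<in> I" "s < t" for s t
  proof -
    have sub: "{s..t} \<subseteq> I"
      using that by (intro Icc_subset_I)
    have inc: "G s < G t"
    proof (rule DERIV_pos_imp_increasing[OF that(3)])
      fix r assume "s \<le> r" "r \<le> t"
      then have "(G has_real_derivative q r) (at r)" using sub by (intro G) auto
      then show "\<exists>y. (G has_real_derivative y) (at r) \<and> 0 < y" by (intro exI conjI) auto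
    qed
    have "N s = (\<integral>\<^sup>+r. ennreal (q r) * indicator {s<..<t} r + ennreal (q r) * indicator (einterval t D) r \<partial>lborel)"
      unfolding emeasure_nu[OF that(1)]
    proof (rule nn_integral_cong_AE)
      show "AE r in lborel. ennreal (q r) * indicator (einterval s D) r
          = ennreal (q r) * indicator {s<..<t} r + ennreal (q r) * indicator (einterval t D) r"
        using AE_lborel_singleton[of t]
        by eventually_elim (use that sub in \<open>auto simp: tail split: split_indicator\<close>)
    qed
    also have "\<dots> = (\<integral>\<^sup>+r\<in>{s<..<t}. ennreal (q r) \<partial>lborel) + N t"
      unfolding emeasure_nu[OF that(2)]
    proof (rule nn_integral_add)
      show "(\<lambda>r. ennreal (q r) * indicator {s<..<t} r) \<in> borel_measurable lborel"
        using borel_measurable_ennreal_indicator[OF continuous_on_subset[OF continuous_on_q], of "{s<..<t}"] sub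
        by (simp add: subset_iff)
      show "(\<lambda>r. ennreal (q r) * indicator (einterval t D) r) \<in> borel_measurable lborel"
        using borel_measurable_ennreal_indicator[OF continuous_on_subset[OF continuous_on_q], of "einterval t D"]
          tail[OF that(2)] by auto
    qed
    also have "(\<integral>\<^sup>+r\<in>{s<..<t}. ennreal (q r) \<partial>lborel) = ennreal (G t - G s)"
      using that(3) sub
      by (intro nn_integral_FTC_Ioo G continuous_on_subset[OF continuous_on_q]) auto
    finally have "ennreal (n s) = ennreal (G t - G s + n t)"
      using inc n_nonneg[of t] by (subst ennreal_plus) (simp_all add: N_eq that)
    then show ?thesis using inc n_nonneg[of s] n_nonneg[of t] by (simp del: ennreal_plus)
  qed
  have n_deriv: "(n has_real_derivative - q t) (at t)" if "t \<in> I" for t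
  proof (rule has_field_derivative_transform_within_open)
    show "((\<lambda>s. n t + G t - G s) has_real_derivative - q t) (at t)"
      using G[OF that] by (auto intro!: derivative_eq_intros)
    show "n t + G t - G s = n s" if "s \<in> I" for s
    proof (cases s t rule: linorder_cases)
      case less
      then show ?thesis using n_diff[OF \<open>s \<in> I\<close> \<open>t \<in> I\<close>] by linarith
    next
      case greater
      then show ?thesis using n_diff[OF \<open>t \<in> I\<close> \<open>s \<in> I\<close>] by linarith
    qed simp
  qed (use that in auto)
  have n_pos: "0 < n t" if "t \<in> I" for t
  proof -
    obtain z where "0 < t" "t < z" "ereal z < D" using \<open>t \<in> I\<close> by (rule mem_IE)
    then have "n t = G z - G t + n z \<and> G t < G z"
      using that by (intro n_diff) (auto simp: einterval_iff zero_ereal_def)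
    moreover have "0 \<le> n z" by (simp add: n_def)
    ultimately show ?thesis by linarith
  qed
  have M_le: "(\<integral>\<^sup>+x\<in>einterval 0 (ereal t). P x \<partial>lborel) \<le> ennreal (\<delta> / n t)" if "t \<in> I" for t
  proof -
    have "M t < \<infinity>" using that by (intro M_finite) (auto simp: einterval_iff)
    then obtain m where m: "M t = ennreal m" "0 \<le> m" by (cases "M t") auto
    then have "m * n t \<le> \<delta>"
      using MN[OF that] \<delta>(2) n_pos[OF that] by (simp add: N_eq[OF that] flip: ennreal_mult)
    then have "m \<le> \<delta> / n t" using n_pos[OF that] by (simp add: field_simps)
    then show ?thesis using m by (simp add: emeasure_mu ennreal_leI)
  qed
  have "(\<integral>\<^sup>+x\<in>I. P x * ennreal ((f x)\<^sup>2) \<partial>lborel)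
      \<le> ennreal (4 * \<delta>) * (\<integral>\<^sup>+t\<in>I. ennreal ((deriv f t)\<^sup>2 / q t) \<partial>lborel)"
  proof (rule muckenhoupt_inequality[where N = n])
    show "ennreal \<bar>f x\<bar> \<le> (\<integral>\<^sup>+t\<in>einterval (ereal x) D. ennreal \<bar>deriv f t\<bar> \<partial>lborel)" if "x \<in> I" for x
      using f bc that by (rule abs_le_nn_integral_deriv)
  qed (fact borel_measurable_P continuous_on_q n_deriv n_pos M_le \<delta>(2) C_K_deriv(2)[OF f] | simp)+
  then show ?thesis
    using \<delta> by (simp add: mu_square[OF f] dirichlet_form_eq[OF f] ennreal_mult)
qed

section \<open>Bounds for the eigenvalue\<close>

lemma lambda0_ge: "inverse (4 * delta a b D) \<le> lambda0 a b D"
proof (cases "delta a b D < \<infinity>")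
  case False
  then show ?thesis by (simp add: ennreal_mult_top less_top[symmetric])
next
  case True
  show ?thesis
    unfolding lambda0_def
  proof (rule Inf_greatest, clarify)
    fix f
    assume "(\<integral>\<^sup>+x. ennreal ((f x)\<^sup>2) \<partial>mu a b D) = 1" "f \<in> C_K D"
      "D < \<infinity> \<longrightarrow> f (real_of_ereal D) = 0"
    then have *: "1 \<le> 4 * delta a b D * dirichlet_form a b D f"
      using hardy_inequality[OF True, of f] by auto
    then have "4 * delta a b D \<noteq> 0" by auto
    moreover have "4 * delta a b D \<noteq> \<infinity>" using True by (auto simp: ennreal_mult_eq_top_iff)
    ultimately have "inverse (4 * delta a b D) * (4 * delta a b D) = 1"
      by (rule ennreal_inverse_mult_self)
    moreover have "inverse (4 * delta a b D) * 1
        \<le> inverse (4 * delta a b D) * (4 * delta a b D * dirichlet_form a b D f)"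
      using * by (rule mult_left_mono) simp
    ultimately show "inverse (4 * delta a b D) \<le> dirichlet_form a b D f"
      by (simp add: mult.assoc[symmetric])
  qed
qed

lemma lambda0_le: "lambda0 a b D \<le> inverse (delta a b D)"
proof -
  consider "delta a b D = 0" | "delta a b D = \<infinity>" | "delta a b D \<noteq> 0" "delta a b D \<noteq> \<infinity>" by blast
  then show ?thesis
  proof cases
    case 1
    then show ?thesis by simp
  next
    case 2
    then have "lambda0 a b D * \<infinity> \<le> 1" using lambda0_mult_delta_le by simp
    then have "lambda0 a b D = 0"
      by (cases "lambda0 a b D = 0") (simp_all add: ennreal_mult_top top_unique)
    then show ?thesis by simp
  next
    case 3
    have "lambda0 a b D * delta a b D * inverse (delta a b D) \<le> 1 * inverse (delta a b D)"
      by (intro mult_right_mono lambda0_mult_delta_le) simp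
    then show ?thesis
      using ennreal_inverse_mult_self[OF 3] by (simp add: mult.assoc mult.commute[of "delta a b D"])
  qed
qed

lemma lambda0_pos_iff: "0 < lambda0 a b D \<longleftrightarrow> delta a b D < \<infinity>"
proof
  assume "0 < lambda0 a b D"
  then show "delta a b D < \<infinity>"
    using lambda0_le by (cases "delta a b D = \<infinity>") (auto simp: less_top)
next
  assume "delta a b D < \<infinity>"
  then have "4 * delta a b D < \<infinity>" by (simp add: ennreal_mult_less_top)
  then have "0 < inverse (4 * delta a b D)" by (simp only: ennreal_inverse_positive infinity_ennreal_def less_top)
  then show "0 < lambda0 a b D" using lambda0_ge by (rule less_le_trans)
qed

text \<open>
  Near \<open>0\<close> the measure \<open>\<nu>\<close> is finite, because \<open>C\<close> is continuous up to the endpoint; hence all the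
  infinite mass lies to the right of \<open>1\<close> and \<open>\<delta> \<ge> M 1 N 1 = \<infinity>\<close>.
\<close>

lemma lambda0_eq_0_if_nu_infinite:
  assumes "emeasure (nu a b D) I = \<infinity>" and "D = \<infinity>"
  shows "lambda0 a b D = 0"
proof -
  have one: "1 \<in> I" unfolding assms(2) by (simp add: einterval_iff)
  have "(\<integral>\<^sup>+t\<in>{0..1}. ennreal (q t) \<partial>lborel) < \<infinity>"
  proof -
    have "set_integrable lborel {0..1} q"
      unfolding set_integrable_def using continuous_on_Cfun_Icc[of 1] assms(2)
      by (intro borel_integrable_compact continuous_intros) auto
    then have "(\<integral>\<^sup>+t. norm (indicator {0..1} t *\<^sub>R q t) \<partial>lborel) < \<infinity>"
      by (simp add: set_integrable_def integrable_iff_bounded)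
    also have "(\<integral>\<^sup>+t. norm (indicator {0..1} t *\<^sub>R q t) \<partial>lborel) = (\<integral>\<^sup>+t\<in>{0..1}. ennreal (q t) \<partial>lborel)"
      by (intro nn_integral_cong) (auto split: split_indicator)
    finally show ?thesis .
  qed
  moreover have "emeasure (nu a b D) {0<..1} \<le> (\<integral>\<^sup>+t\<in>{0..1}. ennreal (q t) \<partial>lborel)"
    unfolding nu_def using nu_density_measurable
    by (subst emeasure_density) (auto intro!: nn_integral_mono split: split_indicator)
  ultimately have fin: "emeasure (nu a b D) {0<..1} < \<infinity>" by (rule le_less_trans[rotated])
  have "emeasure (nu a b D) I = emeasure (nu a b D) ({0<..1} \<union> einterval (ereal 1) D)"
    unfolding assms(2) by (rule arg_cong[where f = "emeasure _"]) (auto simp: einterval_iff)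
  also have "\<dots> \<le> emeasure (nu a b D) {0<..1} + N 1"
    by (rule emeasure_subadditive) (simp_all add: nu_def)
  finally have "N 1 = \<infinity>" using fin assms(1) by (auto simp: top_unique ennreal_add_eq_top)
  then have "M 1 * N 1 = \<infinity>"
    using M_pos[OF one] by (simp add: ennreal_mult_top)
  moreover have "M 1 * N 1 \<le> delta a b D"
    unfolding delta_def using one by (rule SUP_upper)
  ultimately have "\<not> 0 < lambda0 a b D" by (simp add: lambda0_pos_iff top_unique)
  then show ?thesis by simp
qed

lemma delta_le: "delta a b D \<le> (\<integral>\<^sup>+x. M x \<partial>nu a b D)"
  unfolding delta_def
proof (rule SUP_least)
  fix x assume x: "x \<in> I"
  have "M x * N x = (\<integral>\<^sup>+y. M x * indicator (einterval (ereal x) D) y \<partial>nu a b D)"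
    by (subst nn_integral_cmult_indicator) (auto simp: nu_def)
  also have "\<dots> \<le> (\<integral>\<^sup>+y. M y \<partial>nu a b D)"
  proof (rule nn_integral_mono)
    fix y
    show "M x * indicator (einterval (ereal x) D) y \<le> M y"
      by (auto simp: einterval_iff mu_def intro!: emeasure_mono split: split_indicator)
  qed
  finally show "M x * N x \<le> (\<integral>\<^sup>+y. M y \<partial>nu a b D)" .
qed

end

theorem theorem2:
  fixes D :: ereal and a b :: "real \<Rightarrow> real"
  assumes "0 < D"
    and "a \<in> borel_measurable (restrict_space borel (closed_ival D))"
    and "b \<in> borel_measurable (restrict_space borel (closed_ival D))"
    and "\<And>x. x \<in> einterval 0 D \<Longrightarrow> 0 < a x"
    and "locally_integrable_on (closed_ival D) (\<lambda>x. b x / a x)"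
    and "locally_integrable_on (closed_ival D) (\<lambda>x. exp (Cfun a b x) / a x)"
  shows "(lambda0 a b D > 0 \<longleftrightarrow> delta a b D < \<infinity>)
    \<and> inverse (4 * delta a b D) \<le> lambda0 a b D
    \<and> lambda0 a b D \<le> inverse (delta a b D)
    \<and> (D = \<infinity> \<longrightarrow>
         (emeasure (nu a b D) (einterval 0 D) = \<infinity> \<longrightarrow> lambda0 a b D = 0)
       \<and> ((\<integral>\<^sup>+ x. emeasure (mu a b D) (einterval 0 (ereal x)) \<partial>nu a b D) < \<infinity>
            \<longrightarrow> lambda0 a b D > 0))"
proof -
  interpret mixed_eigenvalue_problem D a b
    using assms by unfold_locales
  show ?thesis
  proof (intro conjI impI)
    assume "(\<integral>\<^sup>+ x. emeasure (mu a b D) (einterval 0 (ereal x)) \<partial>nu a b D) < \<infinity>"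
    then show "lambda0 a b D > 0"
      unfolding lambda0_pos_iff using delta_le by (rule le_less_trans[rotated])
  qed (fact lambda0_pos_iff lambda0_ge lambda0_le | rule lambda0_eq_0_if_nu_infinite; assumption)+
qed

end
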